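(* Let $a,b$ be relatively prime positive integers and let $c_1,\dots,c_n$ be positive integers. For $1\le i\le n$ let $d_i$ be the integer with $1\le d_i\le a$ and $bd_i+c_i\equiv 0\pmod a$. Then there is a bijection from $\mathcal{P}_{a,b,c_1,\ldots,c_n}$ to $$\mathcal{Z}_{a,b}\cap\bigcap_{i=1}^{n}\Big\{(z_j)_{j\ge0}:\ \sum_{l=j}^{j+d_i-1}z_l\le \frac{bd_i+c_i}{a}\ \text{ for all } j\ge 0\Big\}.$$ Furthermore, the cardinality of $\mathcal{P}_{a,b,c_1,\ldots,c_n}$ is $$\frac1a\,\Big|\mathcal{Z}'_{a,b}\cap\bigcap_{i=1}^{n}\Big\{(z_j)_{j\ge0}:\ \sum_{l=j}^{j+d_i-1}z_l\le \frac{bd_i+c_i}{a}\ \text{ for all } j\ge 0\Big\}\Big|.$$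
   Context: A partition is a finite nonincreasing sequence of positive integers (the empty partition is allowed). Its Ferrers diagram has $\lambda_j$ nodes in row $j$ (left justified); the hook length of a node is the number of nodes consisting of the node itself, the nodes to its right in the same row and the nodes below it in the same column. $\mathcal{P}_t$ is the set of $t$-core partitions, i.e. partitions with no node of hook length $t$ (equivalently, no hook length divisible by $t$); the empty partition belongs to every $\mathcal{P}_t$. $\mathcal{P}_{t_1,\dots,t_k}=\bigcap_{i=1}^k\mathcal{P}_{t_i}$. $\mathcal{Z}_{a,b}$ is the set of sequences $(z_j)_{j\ge0}$ of nonnegative integers such that $\sum_{l=j}^{j+a-1}z_l=b$ and $\sum_{l=0}^{j-1}z_l\le jb/a$ for all $j\ge0$. $\mathcal{Z}'_{a,b}$ is the set of sequences $(z_j)_{j\ge0}$ of nonnegative integers that are periodic with period $a$ (i.e. $z_{j+a}=z_j$ for all $j\ge0$) and satisfy $\sum_{l=0}^{a-1}z_l=b$. *)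

theory Defs
  imports Complex_Main "HOL-Number_Theory.Cong"
begin

definition is_partition :: "nat list \<Rightarrow> bool" where
  "is_partition p \<longleftrightarrow> sorted_wrt (\<ge>) p \<and> (\<forall>x\<in>set p. 0 < x)"

text \<open>Nodes are pairs (row, column), both counted from 0.\<close>

definition ferrers :: "nat list \<Rightarrow> (nat \<times> nat) set" where
  "ferrers p = {(i, j). i < length p \<and> j < p ! i}"

definition hook :: "nat list \<Rightarrow> nat \<times> nat \<Rightarrow> (nat \<times> nat) set" where
  "hook p v = {w \<in> ferrers p. (fst w = fst v \<and> snd v \<le> snd w) \<or> (snd w = snd v \<and> fst v \<le> fst w)}"

definition hook_length :: "nat list \<Rightarrow> nat \<times> nat \<Rightarrow> nat" where
  "hook_length p v = card (hook p v)"

definition core_partitions :: "nat \<Rightarrow> nat list set" where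
  "core_partitions t = {p. is_partition p \<and> (\<forall>v\<in>ferrers p. hook_length p v \<noteq> t)}"

definition simultaneous_cores :: "nat set \<Rightarrow> nat list set" where
  "simultaneous_cores T = (\<Inter>t\<in>T. core_partitions t)"

definition Zseq :: "nat \<Rightarrow> nat \<Rightarrow> (nat \<Rightarrow> nat) set" where
  "Zseq a b = {z. \<forall>j. (\<Sum>l=j..<j+a. z l) = b \<and>
                       real (\<Sum>l=0..<j. z l) \<le> real j * real b / real a}"

definition Zseq' :: "nat \<Rightarrow> nat \<Rightarrow> (nat \<Rightarrow> nat) set" where
  "Zseq' a b = {z. (\<forall>j. z (j + a) = z j) \<and> (\<Sum>l=0..<a. z l) = b}"

definition window_bounded :: "nat \<Rightarrow> real \<Rightarrow> (nat \<Rightarrow> nat) set" where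
  "window_bounded d B = {z. \<forall>j. real (\<Sum>l=j..<j+d. z l) \<le> B}"

end

theory Submission imports Defs begin

text \<open>
  A partition is determined by the finite set of its first-column hook lengths, which may be any
  finite set \<open>B\<close> of positive integers. The hook lengths in the row that contributes \<open>x \<in> B\<close> are the
  differences \<open>x - y\<close> with \<open>y < x\<close> and \<open>y \<notin> B\<close> (\<open>core_iff_beta_set\<close>). Hence the partition is a
  \<open>t\<close>-core iff the complement \<open>G\<close> of \<open>B\<close> is closed under adding \<open>t\<close>, and simultaneous cores are the
  same as cofinite sets \<open>G\<close> of naturals that contain 0 and are closed under a set of translations.

  A set \<open>G\<close> closed under adding \<open>a\<close> is given by its least element in each residue class modulo \<open>a\<close>.
  As \<open>b\<close> is coprime to \<open>a\<close>, the classes can be listed as those of \<open>0, b, 2b, ...\<close>; let \<open>M j\<close> be the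
  least element of \<open>G\<close> in the class of \<open>j b\<close>. Then \<open>M (j+1)\<close> is congruent to \<open>M j + b\<close>, and \<open>G\<close> is
  closed under adding \<open>b\<close> iff \<open>M (j+1) = M j + b - a z j\<close> with all \<open>z j \<ge> 0\<close>. So \<open>M\<close> is the walk
  \<open>j b - a (z 0 + ... + z (j-1))\<close>, called \<open>height\<close> below, and every condition on \<open>z\<close> is a condition on
  this walk: the window sums of length \<open>a\<close> equal \<open>b\<close> iff the walk has period \<open>a\<close>; the prefix bounds
  say that the walk is nonnegative, i.e. that \<open>0\<close> is the least element of \<open>G\<close>; and the bound on
  windows of length \<open>d\<close> says \<open>M j \<le> M (j+d) + c\<close>. Since \<open>b d + c\<close> is divisible by \<open>a\<close>, adding \<open>c\<close>
  takes the class of \<open>(j+d) b\<close> to that of \<open>j b\<close>, so this is closure under adding \<open>c\<close>. This yields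
  the bijection (\<open>bij_betw_upper_set\<close>).

  For the count, a shift of a periodic sequence translates its walk, so the shift by \<open>k\<close> satisfies
  the prefix bounds iff the walk is minimal at \<open>k\<close>. The heights in one period lie in different
  residue classes, so the minimum is attained exactly once there. Thus every periodic sequence is one
  of the \<open>a\<close> shifts of exactly one sequence with the prefix bounds (\<open>bij_betw_shift\<close>), and the
  window bounds are invariant under shifts.
\<close>

section \<open>Partitions as sets of first-column hook lengths\<close>

definition beta_set :: "nat list \<Rightarrow> nat set" where
  "beta_set p = (\<lambda>i. p ! i + (length p - Suc i)) ` {..<length p}"

lemma beta_set_Nil [simp]: "beta_set [] = {}"
  by (simp add: beta_set_def)

lemma beta_set_Cons [simp]: "beta_set (x # p) = insert (x + length p) (beta_set p)"
  by (simp add: beta_set_def lessThan_Suc_eq_insert_0 image_image)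

lemma finite_beta_set [simp]: "finite (beta_set p)"
  by (simp add: beta_set_def)

lemma is_partition_Cons:
  "is_partition (x # p) \<longleftrightarrow> 0 < x \<and> (\<forall>y\<in>set p. y \<le> x) \<and> is_partition p"
  by (auto simp: is_partition_def)

lemma beta_set_less:
  assumes "\<forall>y\<in>set p. y \<le> x" and "y \<in> beta_set p"
  shows "y < x + length p"
proof -
  obtain i where "i < length p" "y = p ! i + (length p - Suc i)"
    using assms(2) by (auto simp: beta_set_def)
  moreover from this have "p ! i \<le> x" using assms(1) by simp
  ultimately show ?thesis by linarith
qed

lemma zero_notin_beta_set: 
  assumes p: "is_partition p" shows "0 \<notin> beta_set p"
proof
  assume "0 \<in> beta_set p"
  then obtain i where "i < length p" "p ! i = 0" by (auto simp: beta_set_def)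
  then show False using p nth_mem[of i p] unfolding is_partition_def by force
qed

lemma card_beta_set: "is_partition p \<Longrightarrow> card (beta_set p) = length p"
proof (induction p)
  case (Cons x p)
  then have "x + length p \<notin> beta_set p"
    using beta_set_less[of p x "x + length p"] by (auto simp: is_partition_Cons)
  with Cons show ?case by (simp add: is_partition_Cons)
qed simp

lemma Max_beta_set_Cons:
  assumes "is_partition (x # p)"
  shows "Max (beta_set (x # p)) = x + length p"
  using assms beta_set_less[of p x] by (intro Max_eqI) (auto simp: is_partition_Cons intro: less_imp_le)

lemma beta_set_inject:
  assumes "is_partition p" "is_partition q" "beta_set p = beta_set q"
  shows "p = q"
  using assms
proof (induction p arbitrary: q)
  case Nil
  then show ?case using card_beta_set[of q] by simp
next
  case (Cons x p)
  have len: "length q = Suc (length p)"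
    using card_beta_set[OF Cons.prems(1)] card_beta_set[OF Cons.prems(2)] Cons.prems(3) by simp
  then obtain y q' where q: "q = y # q'" by (cases q) auto
  have xy: "x = y"
    using Max_beta_set_Cons[of x p] Max_beta_set_Cons[of y q'] Cons.prems len q by simp
  have "x + length p \<notin> beta_set p" "x + length p \<notin> beta_set q'"
    using beta_set_less[of p x] beta_set_less[of q' y] Cons.prems(1,2) len xy
    by (auto simp: is_partition_Cons q)
  then have "beta_set p = beta_set q'"
    using Cons.prems(3) len xy unfolding q beta_set_Cons
    by (metis Diff_insert_absorb length_Cons nat.inject)
  then show ?case
    using Cons.IH[of q'] Cons.prems q xy by (simp add: is_partition_Cons)
qed

text \<open>The largest element of the set is the hook length at the top of the first column, so it
  determines the first row; the remaining elements belong to the partition without this row.\<close>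

lemma beta_set_surj:
  assumes "finite B" "0 \<notin> B"
  shows "\<exists>p. is_partition p \<and> beta_set p = B"
  using assms
proof (induction B rule: finite_linorder_max_induct)
  case empty
  then show ?case by (intro exI[of _ "[]"]) (simp add: is_partition_def)
next
  case (insert m B)
  then obtain p where p: "is_partition p" "beta_set p = B" by auto
  have ge: "length p \<le> m" "0 < m - length p \<and> (\<forall>y\<in>set p. y \<le> m - length p)"
  proof -
    have "length p \<le> m \<and> 0 < m - length p \<and> (\<forall>y\<in>set p. y \<le> m - length p)"
    proof (cases p)
      case Nil
      then show ?thesis using insert.prems by auto
    next
      case (Cons x q)
      then have "x + length q < m" using p insert.hyps(2) by auto
      then show ?thesis using p(1) Cons by (auto simp: is_partition_Cons)
    qed
    then show "length p \<le> m" "0 < m - length p \<and> (\<forall>y\<in>set p. y \<le> m - length p)" by auto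
  qed
  show ?case
    using ge p by (intro exI[of _ "(m - length p) # p"]) (simp add: is_partition_Cons)
qed

text \<open>Here \<open>k\<close> is the length of column \<open>j\<close>; the two summands are the part of the hook in the row,
  corner included, and the part strictly below the corner.\<close>

lemma hook_length_eq:
  assumes i: "i < k" and j: "j < p ! i"
    and k: "k \<le> length p" and col: "\<And>m. m < length p \<Longrightarrow> j < p ! m \<longleftrightarrow> m < k"
  shows "hook_length p (i, j) = (p ! i - j) + (k - Suc i)"
proof -
  have "hook p (i, j) = Pair i ` {j..<p ! i} \<union> (\<lambda>m. (m, j)) ` {Suc i..<k}"
    using i j k col by (auto simp: hook_def ferrers_def image_iff Suc_le_eq le_eq_less_or_eq)
  moreover have "Pair i ` {j..<p ! i} \<inter> (\<lambda>m. (m, j)) ` {Suc i..<k} = {}" by auto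
  ultimately show ?thesis
    by (simp add: hook_length_def card_Un_disjoint card_image inj_on_def)
qed

lemma partition_nth_mono:
  assumes "is_partition p" "m \<le> m'" "m' < length p"
  shows "p ! m' \<le> p ! m"
  using assms by (cases "m = m'") (auto simp: is_partition_def sorted_wrt_iff_nth_less)

lemma down_closed_initial_segment:
  assumes "\<And>m m'. m \<le> m' \<Longrightarrow> m' < L \<Longrightarrow> P m' \<Longrightarrow> P m"
  shows "\<exists>k\<le>L. \<forall>m<L. P m \<longleftrightarrow> m < (k::nat)"
proof (cases "\<exists>m<L. \<not> P m")
  case True
  define k where "k = (LEAST m. m < L \<and> \<not> P m)"
  have k: "k < L \<and> \<not> P k" unfolding k_def using True by (rule LeastI_ex)
  have "P m" if "m < k" for m
    using not_less_Least[of m "\<lambda>m. m < L \<and> \<not> P m"] that k unfolding k_def by auto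
  then show ?thesis using k assms by (metis less_imp_le not_le)
next
  case False
  then show ?thesis by (intro exI[of _ L]) auto
qed

text \<open>If column \<open>j\<close> has length \<open>k\<close>, then \<open>j + (length p - k)\<close> is not in the set \<open>B\<close> of first-column
  hook lengths, and every natural number outside \<open>B\<close> arises in this way from exactly one \<open>j\<close>. The
  hook length at \<open>(i, j)\<close> is the \<open>i\<close>-th element of \<open>B\<close> minus this number. So a hook of length \<open>t\<close> is the
  same as a number \<open>y\<close> outside \<open>B\<close> with \<open>y + t\<close> in \<open>B\<close>.\<close>

lemma core_iff_beta_set:
  assumes p: "is_partition p" and t: "0 < t"
  shows "p \<in> core_partitions t \<longleftrightarrow> (\<forall>y. y \<notin> beta_set p \<longrightarrow> y + t \<notin> beta_set p)"
proof -
  let ?L = "length p"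
  have "(\<exists>v\<in>ferrers p. hook_length p v = t) \<longleftrightarrow> (\<exists>y. y \<notin> beta_set p \<and> y + t \<in> beta_set p)"
  proof
    assume "\<exists>v\<in>ferrers p. hook_length p v = t"
    then obtain i j where ij: "i < ?L" "j < p ! i" and h: "hook_length p (i, j) = t"
      by (auto simp: ferrers_def)
    have "\<exists>k\<le>?L. \<forall>m<?L. j < p ! m \<longleftrightarrow> m < k"
      by (rule down_closed_initial_segment) (use partition_nth_mono[OF p] less_le_trans in blast)
    then obtain k where k: "k \<le> ?L" "\<forall>m<?L. j < p ! m \<longleftrightarrow> m < k" by blast
    have ik: "i < k" using ij k by blast
    have t_eq: "t = (p ! i - j) + (k - Suc i)"
      using hook_length_eq[OF ik ij(2) k(1)] k(2) h by simp
    let ?y = "j + (?L - k)"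
    \<comment> \<open>Row \<open>m\<close> contributes a number above \<open>?y\<close> if it meets column \<open>j\<close>, and one below \<open>?y\<close> otherwise.\<close>
    have "?y \<noteq> p ! m + (?L - Suc m)" if m: "m < ?L" for m
    proof (cases "m < k")
      case True
      then have "j < p ! m" using k m by blast
      then show ?thesis using True m k(1) by linarith
    next
      case False
      then have "p ! m \<le> j" using k m by (meson not_le)
      then show ?thesis using False m k(1) by linarith
    qed
    then have "?y \<notin> beta_set p" by (auto simp: beta_set_def)
    moreover have "?y + t = p ! i + (?L - Suc i)"
      using t_eq ik ij k(1) by linarith
    then have "?y + t \<in> beta_set p" using ij(1) by (auto simp: beta_set_def)
    ultimately show "\<exists>y. y \<notin> beta_set p \<and> y + t \<in> beta_set p" by blast
  next
    assume "\<exists>y. y \<notin> beta_set p \<and> y + t \<in> beta_set p"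
    then obtain y i where y: "y \<notin> beta_set p" and i: "i < ?L"
      and yt: "y + t = p ! i + (?L - Suc i)"
      by (auto simp: beta_set_def)
    let ?x = "\<lambda>m. p ! m + (?L - Suc m)"
    have ne: "?x m \<noteq> y" if "m < ?L" for m using y that by (auto simp: beta_set_def)
    have anti: "?x m' \<le> ?x m" if "m \<le> m'" "m' < ?L" for m m'
      using partition_nth_mono[OF p that] that by linarith
    have "\<exists>k\<le>?L. \<forall>m<?L. y < ?x m \<longleftrightarrow> m < k"
      by (rule down_closed_initial_segment) (use anti less_le_trans in blast)
    then obtain k where k: "k \<le> ?L" "\<And>m. m < ?L \<Longrightarrow> y < ?x m \<longleftrightarrow> m < k" by blast
    have ik: "i < k" using k(2)[OF i] yt t by linarith
    \<comment> \<open>The last \<open>?L - k\<close> rows contribute distinct numbers below \<open>y\<close>.\<close>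
    have ge: "?L - k \<le> y"
    proof (cases "k < ?L")
      case True
      then have "?x k < y" using k(2)[of k] ne[of k] by linarith
      then show ?thesis using True by linarith
    qed simp
    define j where "j = y - (?L - k)"
    have yj: "y = j + (?L - k)" using ge j_def by simp
    have hi: "j < p ! (k - 1)"
      using k(2)[of "k - 1"] ik k(1) yj by simp linarith
    have lo: "p ! k \<le> j" if "k < ?L"
      using k(2)[of k] ne[of k] that yj by linarith
    have col: "j < p ! m \<longleftrightarrow> m < k" if m: "m < ?L" for m
    proof (cases "m < k")
      case True
      then have "p ! (k - 1) \<le> p ! m" using k(1) by (intro partition_nth_mono[OF p]) auto
      then show ?thesis using True hi by simp
    next
      case False
      then have "p ! m \<le> p ! k" using m by (intro partition_nth_mono[OF p]) auto
      then show ?thesis using False lo m by simp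
    qed
    have ji: "j < p ! i" using col[OF i] ik by blast
    have "hook_length p (i, j) = t"
      using hook_length_eq[OF ik ji k(1) col] yt yj ik ji k(1) by linarith
    moreover have "(i, j) \<in> ferrers p" using i ji by (simp add: ferrers_def)
    ultimately show "\<exists>v\<in>ferrers p. hook_length p v = t" by blast
  qed
  then show ?thesis unfolding core_partitions_def mem_Collect_eq using p by blast
qed

definition closed_cofinite :: "nat set \<Rightarrow> nat set set" where
  "closed_cofinite T = {G. 0 \<in> G \<and> finite (- G) \<and> (\<forall>t\<in>T. \<forall>x\<in>G. x + t \<in> G)}"

text \<open>Passing to complements turns ``no \<open>y\<close> outside with \<open>y + t\<close> inside'' into closure under adding
  \<open>t\<close>, and ``0 is not a hook length'' into membership of 0. Nonemptiness of \<open>T\<close> matters because the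
  empty intersection contains lists that are not partitions.\<close>

lemma bij_betw_cores_closed_cofinite:
  assumes "T \<noteq> {}" and pos: "\<And>t. t \<in> T \<Longrightarrow> 0 < t"
  shows "bij_betw (\<lambda>p. - beta_set p) (simultaneous_cores T) (closed_cofinite T)"
proof (rule bij_betw_imageI)
  have part: "is_partition p" if "p \<in> simultaneous_cores T" for p
    using that assms(1) by (auto simp: simultaneous_cores_def core_partitions_def)
  have core: "p \<in> simultaneous_cores T \<longleftrightarrow> (\<forall>t\<in>T. \<forall>x\<in>- beta_set p. x + t \<in> - beta_set p)"
    if "is_partition p" for p
    using core_iff_beta_set[OF that pos] by (auto simp: simultaneous_cores_def)
  show "inj_on (\<lambda>p. - beta_set p) (simultaneous_cores T)"
    by (rule inj_onI) (simp add: beta_set_inject part)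
  show "(\<lambda>p. - beta_set p) ` simultaneous_cores T = closed_cofinite T"
  proof (intro set_eqI iffI)
    fix G assume "G \<in> (\<lambda>p. - beta_set p) ` simultaneous_cores T"
    then obtain p where "p \<in> simultaneous_cores T" and G: "G = - beta_set p" by blast
    then show "G \<in> closed_cofinite T"
      using core[OF part] part zero_notin_beta_set unfolding closed_cofinite_def by auto
  next
    fix G assume G: "G \<in> closed_cofinite T"
    then obtain p where p: "is_partition p" "beta_set p = - G"
      using beta_set_surj[of "- G"] by (auto simp: closed_cofinite_def)
    then have "p \<in> simultaneous_cores T" using G core by (auto simp: closed_cofinite_def)
    then show "G \<in> (\<lambda>p. - beta_set p) ` simultaneous_cores T" using p by force
  qed
qed

section \<open>Heights of a sequence\<close>

text \<open>For a sequence \<open>z\<close> that comes from a closed set, \<open>height a b z j\<close> is the least element of the set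
  in the residue class of \<open>j b\<close> modulo \<open>a\<close>. It is an integer because a periodic sequence without
  the prefix bounds may have negative heights.\<close>

definition height :: "nat \<Rightarrow> nat \<Rightarrow> (nat \<Rightarrow> nat) \<Rightarrow> nat \<Rightarrow> int" where
  "height a b z j = int (j * b) - int a * int (\<Sum>l<j. z l)"

lemma height_0 [simp]: "height a b z 0 = 0"
  by (simp add: height_def)

lemma height_Suc: "height a b z (Suc j) = height a b z j + int b - int a * int (z j)"
  by (simp add: height_def algebra_simps)

lemma height_add:
  "height a b z (j + d) = height a b z j + int (d * b) - int a * int (\<Sum>l=j..<j+d. z l)"
  by (induction d) (simp_all add: height_Suc algebra_simps)

lemma height_shift: "height a b (\<lambda>l. z (l + k)) j = height a b z (k + j) - height a b z k"
  by (induction j) (simp_all add: height_Suc algebra_simps)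

lemma height_inject:
  assumes "0 < a" "\<And>j. height a b z j = height a b z' j"
  shows "z = z'"
proof
  fix j show "z j = z' j"
    using assms(2)[of j] assms(2)[of "Suc j"] assms(1) by (simp add: height_Suc)
qed

lemma cong_height: "[height a b z j = int (j * b)] (mod int a)"
  by (simp add: height_def cong_iff_dvd_diff)

lemma Zseq'_iff_height:
  assumes "0 < a"
  shows "z \<in> Zseq' a b \<longleftrightarrow> (\<forall>j. height a b z (j + a) = height a b z j)"
proof
  assume z: "z \<in> Zseq' a b"
  show "\<forall>j. height a b z (j + a) = height a b z j"
  proof
    fix j show "height a b z (j + a) = height a b z j"
    proof (induction j)
      case 0
      then show ?case using z by (simp add: height_def Zseq'_def atLeast0LessThan)
    next
      case (Suc j)
      then show ?case using z by (simp add: height_Suc Zseq'_def)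
    qed
  qed
next
  assume h: "\<forall>j. height a b z (j + a) = height a b z j"
  have "z (j + a) = z j" for j
    using h[rule_format, of j] h[rule_format, of "Suc j"] assms by (simp add: height_Suc)
  moreover have "(\<Sum>l=0..<a. z l) = b"
    using h[rule_format, of 0] assms
    by (simp add: height_def atLeast0LessThan flip: of_nat_mult of_nat_sum)
  ultimately show "z \<in> Zseq' a b" by (simp add: Zseq'_def)
qed

lemma Zseq_iff_height:
  assumes "0 < a"
  shows "z \<in> Zseq a b \<longleftrightarrow> z \<in> Zseq' a b \<and> (\<forall>j. 0 \<le> height a b z j)"
proof -
  have 1: "(\<Sum>l=j..<j+a. z l) = b \<longleftrightarrow> height a b z (j + a) = height a b z j" for j
    using assms by (auto simp: height_add simp flip: of_nat_mult of_nat_sum)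
  have 2: "real (\<Sum>l=0..<j. z l) \<le> real j * real b / real a \<longleftrightarrow> 0 \<le> height a b z j" for j
  proof -
    have "real (\<Sum>l=0..<j. z l) \<le> real j * real b / real a
        \<longleftrightarrow> real (a * (\<Sum>l<j. z l)) \<le> real (j * b)"
      using assms by (simp add: pos_le_divide_eq atLeast0LessThan mult.commute)
    also have "\<dots> \<longleftrightarrow> int (a * (\<Sum>l<j. z l)) \<le> int (j * b)"
      unfolding of_nat_le_iff ..
    also have "\<dots> \<longleftrightarrow> 0 \<le> height a b z j" by (simp add: height_def)
    finally show ?thesis .
  qed
  show ?thesis using 1 2 Zseq'_iff_height[OF assms] by (simp add: Zseq_def all_conj_distrib)
qed

lemma window_bounded_iff_height:
  assumes "0 < a"
  shows "z \<in> window_bounded d (real (b * d + c) / real a)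
    \<longleftrightarrow> (\<forall>j. height a b z j \<le> height a b z (j + d) + int c)"
proof -
  have "real (\<Sum>l=j..<j+d. z l) \<le> real (b * d + c) / real a
      \<longleftrightarrow> height a b z j \<le> height a b z (j + d) + int c" for j
  proof -
    have "real (\<Sum>l=j..<j+d. z l) \<le> real (b * d + c) / real a
        \<longleftrightarrow> real (a * (\<Sum>l=j..<j+d. z l)) \<le> real (b * d + c)"
      using assms by (simp add: pos_le_divide_eq mult.commute)
    also have "\<dots> \<longleftrightarrow> int (a * (\<Sum>l=j..<j+d. z l)) \<le> int (b * d + c)"
      unfolding of_nat_le_iff ..
    also have "\<dots> \<longleftrightarrow> height a b z j \<le> height a b z (j + d) + int c"
      by (auto simp: height_add mult.commute)
    finally show ?thesis .
  qed
  then show ?thesis by (simp add: window_bounded_def)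
qed

lemma shift_window_bounded:
  assumes "z \<in> window_bounded d B" shows "(\<lambda>l. z (l + k)) \<in> window_bounded d B"
proof -
  have "(\<Sum>l=j..<j+d. z (l + k)) = (\<Sum>l=j+k..<j+k+d. z l)" for j
    using sum.shift_bounds_nat_ivl[of z j k "j + d"] by (simp add: add_ac)
  then show ?thesis using assms unfolding window_bounded_def mem_Collect_eq by metis
qed

lemma height_cong:
  assumes "0 < a" "z \<in> Zseq' a b" "[j = k] (mod a)"
  shows "height a b z j = height a b z k"
proof -
  have per: "height a b z (j + m * a) = height a b z j" for j m
  proof (induction m)
    case (Suc m)
    have "height a b z (j + m * a + a) = height a b z (j + m * a)"
      using assms(1,2) Zseq'_iff_height by blast
    with Suc show ?case by (simp add: algebra_simps)
  qed simp
  have "height a b z j = height a b z (j mod a)" for j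
    using per[of "j mod a" "j div a"] by simp
  then show ?thesis using assms(3) by (metis cong_def)
qed

lemma coprime_cong_index:
  fixes a b :: nat
  assumes "coprime a b" "0 < a"
  shows "\<exists>j<a. [x = j * b] (mod a)"
proof -
  obtain y where y: "[b * y = 1] (mod a)"
    using assms(1) cong_solve_coprime_nat[of b a] by (auto simp: coprime_commute)
  have "[(x * y mod a) * b = x * y * b] (mod a)"
    by (intro cong_mult) auto
  also have "x * y * b = x * (b * y)" by simp
  also have "[x * (b * y) = x * 1] (mod a)"
    by (rule cong_mult[OF cong_refl y])
  finally show ?thesis
    using assms(2) by (intro exI[of _ "x * y mod a"]) (simp add: cong_sym)
qed

section \<open>Closed sets from sequences\<close>

definition upper_set :: "nat \<Rightarrow> nat \<Rightarrow> (nat \<Rightarrow> nat) \<Rightarrow> nat set" where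
  "upper_set a b z = {x. \<exists>j. [x = j * b] (mod a) \<and> height a b z j \<le> int x}"

lemma upper_setI: "[x = j * b] (mod a) \<Longrightarrow> height a b z j \<le> int x \<Longrightarrow> x \<in> upper_set a b z"
  unfolding upper_set_def by blast

context
  fixes a b :: nat
  assumes a: "0 < a" and ab: "coprime a b"
begin

text \<open>One index decides membership: by coprimality, two indices of the same residue class differ by a
  multiple of \<open>a\<close>, and the height has period \<open>a\<close>.\<close>

lemma mem_upper_set_iff:
  assumes z: "z \<in> Zseq' a b" and x: "[x = j * b] (mod a)"
  shows "x \<in> upper_set a b z \<longleftrightarrow> height a b z j \<le> int x"
proof -
  have "height a b z i = height a b z j" if "[x = i * b] (mod a)" for i
  proof -
    have "[i * b = j * b] (mod a)" using that x cong_sym cong_trans by blast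
    then have "[i = j] (mod a)" using ab by (simp add: cong_mult_rcancel_nat coprime_commute)
    then show ?thesis using height_cong a z by blast
  qed
  then show ?thesis using x unfolding upper_set_def mem_Collect_eq by metis
qed

text \<open>Adding \<open>c\<close> moves the class of index \<open>j + d\<close> to that of index \<open>j\<close>, because
  \<open>(j + d) b + c = j b + (b d + c)\<close>.\<close>

lemma upper_set_add_closed:
  assumes z: "z \<in> Zseq' a b" and d: "[b * d + c = 0] (mod a)"
    and le: "\<And>j. height a b z j \<le> height a b z (j + d) + int c"
    and x: "x \<in> upper_set a b z"
  shows "x + c \<in> upper_set a b z"
proof -
  obtain i where i: "[x + c = i * b] (mod a)" using coprime_cong_index[OF ab a] by blast
  have "[x + c + b * d = i * b + b * d] (mod a)" by (rule cong_add[OF i cong_refl])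
  moreover have "[x + (b * d + c) = x + 0] (mod a)" by (rule cong_add[OF cong_refl d])
  ultimately have "[x = (i + d) * b] (mod a)"
    by (simp add: cong_def algebra_simps)
  then have "height a b z (i + d) \<le> int x" using x mem_upper_set_iff[OF z] by blast
  then have "height a b z i \<le> int (x + c)" using le[of i] by simp
  then show ?thesis by (rule upper_setI[OF i])
qed

text \<open>Closure under \<open>a\<close> and under \<open>b\<close> are also instances of \<open>upper_set_add_closed\<close>, with index shifts
  \<open>0\<close> and \<open>a - 1\<close>. The complement is finite since the height at \<open>j < a\<close> is at most \<open>j b\<close>.\<close>

lemma upper_set_mem_closed_cofinite:
  fixes c d :: "'i \<Rightarrow> nat"
  assumes z': "z \<in> Zseq' a b" and d: "\<And>i. i \<in> I \<Longrightarrow> [b * d i + c i = 0] (mod a)"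
    and le: "\<And>i j. i \<in> I \<Longrightarrow> height a b z j \<le> height a b z (j + d i) + int (c i)"
  shows "upper_set a b z \<in> closed_cofinite ({a, b} \<union> c ` I)"
proof -
  have per: "height a b z (j + a) = height a b z j" for j
    using z' Zseq'_iff_height a by blast
  have "0 \<in> upper_set a b z" by (rule upper_setI[of _ 0]) simp_all
  moreover have "finite (- upper_set a b z)"
  proof (rule finite_subset)
    show "- upper_set a b z \<subseteq> {..<a * b}"
    proof (intro subsetI, rule ccontr)
      fix x assume x: "x \<in> - upper_set a b z" "x \<notin> {..<a * b}"
      obtain j where j: "j < a" "[x = j * b] (mod a)" using coprime_cong_index[OF ab a] by blast
      have "j * b \<le> x" using mult_le_mono1[of j a b] j(1) x(2) unfolding lessThan_iff by linarith
      have "height a b z j \<le> int (j * b)" by (simp add: height_def sum_nonneg)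
      also have "\<dots> \<le> int x" using \<open>j * b \<le> x\<close> by (rule of_nat_mono)
      finally show False using upper_setI[OF j(2)] x(1) by blast
    qed
  qed simp
  moreover have "x + a \<in> upper_set a b z" if "x \<in> upper_set a b z" for x
    using upper_set_add_closed[OF z' _ _ that, of 0 a] by (simp add: cong_def)
  moreover have "x + b \<in> upper_set a b z" if x: "x \<in> upper_set a b z" for x
  proof (rule upper_set_add_closed[OF z' _ _ x])
    have "b * (a - 1) + b = b * a" using a by (cases a) auto
    then show "[b * (a - 1) + b = 0] (mod a)" by (simp only: cong_def) simp
    fix j
    have "height a b z j = height a b z (Suc (j + (a - 1)))" using per[of j] a by simp
    also have "\<dots> \<le> height a b z (j + (a - 1)) + int b" unfolding height_Suc by simp
    finally show "height a b z j \<le> height a b z (j + (a - 1)) + int b" .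
  qed
  moreover have "x + c i \<in> upper_set a b z" if "i \<in> I" "x \<in> upper_set a b z" for i x
    using upper_set_add_closed[OF z' d le that(2)] that(1) by blast
  ultimately show ?thesis by (auto simp: closed_cofinite_def)
qed

text \<open>A nonnegative height is itself an element of the set, so it is the least element of its class
  and can be read off from the set.\<close>

lemma upper_set_inject:
  assumes z: "z \<in> Zseq a b" and z': "z' \<in> Zseq a b" and eq: "upper_set a b z = upper_set a b z'"
  shows "z = z'"
proof -
  have le: "height a b w' j \<le> height a b w j"
    if w: "w \<in> Zseq a b" and w': "w' \<in> Zseq a b" and eq: "upper_set a b w = upper_set a b w'"
    for w w' j
  proof -
    define x where "x = nat (height a b w j)"
    have x: "int x = height a b w j"
      using w Zseq_iff_height[OF a] by (simp add: x_def)
    have xj: "[x = j * b] (mod a)"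
      using cong_height[of a b w j] unfolding x[symmetric] cong_int_iff .
    then have "x \<in> upper_set a b w'" using x eq upper_setI[OF xj, of w] by simp
    then show ?thesis using mem_upper_set_iff[OF _ xj] w' Zseq_iff_height[OF a] x by auto
  qed
  show ?thesis using a le[OF z z' eq] le[OF z' z eq[symmetric]]
    by (intro height_inject[of a b]) (auto intro: antisym)
qed

text \<open>The sequence is recovered from the least elements \<open>M j\<close> of the residue classes: closure under
  adding \<open>b\<close> gives \<open>M (Suc j) \<le> M j + b\<close>, and the two sides are congruent modulo \<open>a\<close>, so their
  difference is \<open>a\<close> times a natural number \<open>z j\<close>.\<close>

lemma upper_set_surj:
  fixes c d :: "'i \<Rightarrow> nat"
  assumes d: "\<And>i. i \<in> I \<Longrightarrow> [b * d i + c i = 0] (mod a)"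
    and G: "G \<in> closed_cofinite ({a, b} \<union> c ` I)"
  shows "\<exists>z\<in>Zseq a b. upper_set a b z = G \<and>
    (\<forall>i\<in>I. \<forall>j. height a b z j \<le> height a b z (j + d i) + int (c i))"
proof -
  have G0: "0 \<in> G" and Ga: "\<And>x. x \<in> G \<Longrightarrow> x + a \<in> G" and Gb: "\<And>x. x \<in> G \<Longrightarrow> x + b \<in> G"
    and Gc: "\<And>i x. i \<in> I \<Longrightarrow> x \<in> G \<Longrightarrow> x + c i \<in> G"
    using G by (auto simp: closed_cofinite_def)
  have jb: "j * b \<in> G" for j
    by (induction j) (use G0 Gb in \<open>simp_all add: add.commute[of b]\<close>)
  have Gma: "x + m * a \<in> G" if "x \<in> G" for x m
  proof (induction m)
    case (Suc m)
    then show ?case using Ga[of "x + m * a"] by (simp add: algebra_simps)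
  qed (use that in simp)
  \<comment> \<open>The least element exists because \<open>j * b\<close> itself lies in \<open>G\<close>.\<close>
  define M where "M j = (LEAST x. x \<in> G \<and> [x = j * b] (mod a))" for j
  have M: "M j \<in> G" "[M j = j * b] (mod a)" for j
    using LeastI[of "\<lambda>x. x \<in> G \<and> [x = j * b] (mod a)" "j * b"] jb[of j] by (auto simp: M_def)
  have M_le: "M j \<le> x" if "x \<in> G" "[x = j * b] (mod a)" for x j
    unfolding M_def using that by (intro Least_le) auto
  have M0: "M 0 = 0" using M_le[of 0 0] G0 by simp
  have M_per: "M (j + a) = M j" for j
    by (simp add: M_def cong_def algebra_simps)
  define z where "z j = (M j + b - M (Suc j)) div a" for j
  have step: "M j + b = M (Suc j) + a * z j" for j
  proof -
    have c: "[M j + b = Suc j * b] (mod a)"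
      using cong_add[OF M(2)[of j] cong_refl[of b]] by (simp add: add.commute)
    have le: "M (Suc j) \<le> M j + b" using M_le[OF Gb[OF M(1)] c] .
    have "[M j + b = M (Suc j)] (mod a)" using c M(2)[of "Suc j"] cong_sym cong_trans by blast
    then have "a dvd M j + b - M (Suc j)"
      using le by (simp add: cong_altdef_nat)
    then show ?thesis using le by (simp add: z_def)
  qed
  have h: "height a b z j = int (M j)" for j
  proof (induction j)
    case (Suc j)
    have "int (M j) + int b = int (M (Suc j)) + int a * int (z j)"
      using step[of j] by (metis of_nat_add of_nat_mult)
    with Suc show ?case by (simp add: height_Suc)
  qed (simp add: M0)
  have zZ: "z \<in> Zseq a b"
    by (simp add: Zseq_iff_height[OF a] Zseq'_iff_height[OF a] h M_per)
  have "upper_set a b z = G"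
  proof (intro set_eqI iffI)
    fix x assume "x \<in> upper_set a b z"
    then obtain j where j: "[x = j * b] (mod a)" "M j \<le> x"
      unfolding upper_set_def mem_Collect_eq h of_nat_le_iff by blast
    have "[x = M j] (mod a)" using j(1) M(2)[of j] cong_sym cong_trans by blast
    then have "a dvd x - M j" using j(2) by (simp add: cong_altdef_nat)
    then obtain m where "x - M j = m * a" by (metis dvd_def mult.commute)
    then have "x = M j + m * a" using j(2) by simp
    then show "x \<in> G" using Gma M(1) by blast
  next
    fix x assume x: "x \<in> G"
    obtain j where "[x = j * b] (mod a)" using coprime_cong_index[OF ab a] by blast
    then show "x \<in> upper_set a b z" using M_le[OF x] upper_setI[of x] h by (metis of_nat_le_iff)
  qed
  moreover have "M j \<le> M (j + d i) + c i" if i: "i \<in> I" for i j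
  proof (rule M_le)
    show "M (j + d i) + c i \<in> G" using Gc i M(1) by blast
    have "[M (j + d i) + c i = (j + d i) * b + c i] (mod a)" by (rule cong_add[OF M(2) cong_refl])
    also have "(j + d i) * b + c i = j * b + (b * d i + c i)" by (simp add: algebra_simps)
    also have "[j * b + (b * d i + c i) = j * b + 0] (mod a)" by (rule cong_add[OF cong_refl d[OF i]])
    finally show "[M (j + d i) + c i = j * b] (mod a)" by simp
  qed
  then have "\<forall>i\<in>I. \<forall>j. height a b z j \<le> height a b z (j + d i) + int (c i)"
    by (simp add: h flip: of_nat_add)
  ultimately show ?thesis using zZ by blast
qed

lemma bij_betw_upper_set:
  fixes c d :: "'i \<Rightarrow> nat"
  assumes d: "\<And>i. i \<in> I \<Longrightarrow> [b * d i + c i = 0] (mod a)"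
  shows "bij_betw (upper_set a b)
    (Zseq a b \<inter> (\<Inter>i\<in>I. window_bounded (d i) (real (b * d i + c i) / real a)))
    (closed_cofinite ({a, b} \<union> c ` I))" (is "bij_betw _ (_ \<inter> ?W) ?C")
proof (rule bij_betw_imageI)
  have W: "z \<in> ?W \<longleftrightarrow> (\<forall>i\<in>I. \<forall>j. height a b z j \<le> height a b z (j + d i) + int (c i))" for z
    unfolding INT_iff window_bounded_iff_height[OF a] ..
  show "inj_on (upper_set a b) (Zseq a b \<inter> ?W)"
    by (rule inj_onI) (rule upper_set_inject; elim IntE; assumption)
  show "upper_set a b ` (Zseq a b \<inter> ?W) = ?C"
  proof (intro set_eqI iffI)
    fix G assume "G \<in> upper_set a b ` (Zseq a b \<inter> ?W)"
    then obtain z where z: "z \<in> Zseq' a b" "z \<in> ?W" and G: "G = upper_set a b z"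
      using Zseq_iff_height[OF a] by blast
    have le: "height a b z j \<le> height a b z (j + d i) + int (c i)" if "i \<in> I" for i j
      using z(2) that unfolding W by blast
    show "G \<in> ?C" unfolding G using z(1) d le by (rule upper_set_mem_closed_cofinite)
  next
    fix G assume "G \<in> ?C"
    from upper_set_surj[OF d this]
    obtain z where "z \<in> Zseq a b" "upper_set a b z = G" "z \<in> ?W" unfolding W[symmetric] by blast
    then show "G \<in> upper_set a b ` (Zseq a b \<inter> ?W)" by blast
  qed
qed

end

section \<open>Cyclic shifts\<close>

lemma shift_shift_back:
  assumes "z \<in> Zseq' a b" "k \<le> a"
  shows "z (l + k + (a - k)) = z l" "z (l + (a - k) + k) = z l"
  using assms by (simp_all add: Zseq'_def)

context
  fixes a b :: nat
  assumes a: "0 < a"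
begin

text \<open>A sequence of period \<open>a\<close> and sum \<open>b\<close> is given by a word of length \<open>a\<close> over \<open>{..b}\<close>.\<close>

lemma finite_Zseq': "finite (Zseq' a b)"
proof -
  have inj: "inj_on (\<lambda>z. map z [0..<a]) (Zseq' a b)"
  proof (rule inj_onI)
    fix z w assume z: "z \<in> Zseq' a b" and w: "w \<in> Zseq' a b" and "map z [0..<a] = map w [0..<a]"
    then have eq: "z j = w j" if "j < a" for j using that by simp
    have "z j = w j" for j
    proof (induction j rule: less_induct)
      case (less j)
      show ?case
      proof (cases "j < a")
        case False
        then have "z (j - a) = w (j - a)" using a by (intro less) auto
        moreover have "z (j - a + a) = z (j - a)" "w (j - a + a) = w (j - a)"
          using z w unfolding Zseq'_def by blast+
        ultimately show ?thesis using False by simp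
      qed (rule eq)
    qed
    then show "z = w" by blast
  qed
  have "(\<lambda>z. map z [0..<a]) ` Zseq' a b \<subseteq> {xs. set xs \<subseteq> {..b} \<and> length xs = a}"
  proof clarsimp
    fix z l assume "z \<in> Zseq' a b" "l < a"
    then show "z l \<le> b" using member_le_sum[of l "{0..<a}" z] by (auto simp: Zseq'_def)
  qed
  then have "finite ((\<lambda>z. map z [0..<a]) ` Zseq' a b)"
    by (rule finite_subset) (rule finite_lists_length_eq[OF finite_atMost])
  then show ?thesis using inj by (rule finite_imageD)
qed

lemma shift_Zseq':
  assumes "z \<in> Zseq' a b" shows "(\<lambda>l. z (l + k)) \<in> Zseq' a b"
proof -
  have "height a b z (k + (j + a)) = height a b z (k + j)" for j
    using assms Zseq'_iff_height[OF a] by (simp flip: add.assoc)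
  then show ?thesis using Zseq'_iff_height[OF a] by (simp add: height_shift)
qed

text \<open>The shift by \<open>k\<close> subtracts the height at \<open>k\<close> from the walk, so nonnegativity of the shifted walk
  means minimality at \<open>k\<close>; periodicity extends the comparison to indices before \<open>k\<close>.\<close>

lemma shift_Zseq_iff:
  assumes "z \<in> Zseq' a b"
  shows "(\<lambda>l. z (l + k)) \<in> Zseq a b \<longleftrightarrow> (\<forall>j. height a b z k \<le> height a b z j)"
proof -
  have "(\<exists>i. height a b z (k + i) = height a b z j)" for j
  proof (intro exI height_cong[OF a assms])
    have "k + (j + k * (a - 1)) = j + k * a" using a by (cases a) auto
    then show "[k + (j + k * (a - 1)) = j] (mod a)" unfolding cong_def by (metis mod_mult_self1)
  qed
  moreover have "(\<lambda>l. z (l + k)) \<in> Zseq a b \<longleftrightarrow> (\<forall>i. height a b z k \<le> height a b z (k + i))"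
    using shift_Zseq'[OF assms] by (simp add: Zseq_iff_height[OF a] height_shift)
  ultimately show ?thesis by metis
qed

end

context
  fixes a b :: nat
  assumes a: "0 < a" and ab: "coprime a b"
begin

text \<open>Uniqueness: the height at \<open>j\<close> is congruent to \<open>j b\<close> modulo \<open>a\<close>, and \<open>b\<close> is coprime to \<open>a\<close>, so
  equal heights in one period can only occur at the same index.\<close>

lemma ex1_minimal_height:
  assumes z: "z \<in> Zseq' a b"
  shows "\<exists>!k. k < a \<and> (\<forall>j. height a b z k \<le> height a b z j)"
proof (rule ex_ex1I)
  let ?H = "height a b z ` {..<a}"
  have "Min ?H \<in> ?H" using a by (intro Min_in) auto
  then obtain k where "k < a" and min: "height a b z k = Min ?H" by force
  have k: "k < a" "\<And>j. j < a \<Longrightarrow> height a b z k \<le> height a b z j"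
    using \<open>k < a\<close> unfolding min by (auto intro: Min_le)
  have "height a b z k \<le> height a b z j" for j
    using k(2)[of "j mod a"] height_cong[OF a z, of j "j mod a"] a by (simp add: cong_def)
  then show "\<exists>k<a. \<forall>j. height a b z k \<le> height a b z j" using k(1) by blast
next
  fix k k' assume k: "k < a \<and> (\<forall>j. height a b z k \<le> height a b z j)"
    and k': "k' < a \<and> (\<forall>j. height a b z k' \<le> height a b z j)"
  then have "height a b z k = height a b z k'" by (intro antisym) auto
  then have "[int (k * b) = int (k' * b)] (mod int a)"
    using cong_height[of a b z k] cong_height[of a b z k'] cong_sym cong_trans by metis
  then have "[k * b = k' * b] (mod a)" using cong_int_iff by blast
  then have "[k = k'] (mod a)" using ab by (simp add: cong_mult_rcancel_nat coprime_commute)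
  then show "k = k'" using k k' by (simp add: cong_def)
qed

text \<open>The shift is by \<open>a - k\<close> so that \<open>k\<close> is the position of the minimal height of the shifted sequence; this
  makes \<open>k\<close>, and then \<open>z\<close>, recoverable from the image.\<close>

lemma bij_betw_shift:
  assumes W: "\<And>z k. z \<in> W \<Longrightarrow> (\<lambda>l. z (l + k)) \<in> W"
  shows "bij_betw (\<lambda>(k, z). (\<lambda>l. z (l + (a - k)))) ({..<a} \<times> (Zseq a b \<inter> W)) (Zseq' a b \<inter> W)"
proof (rule bij_betwI')
  note Z = Zseq_iff_height[OF a]
  have minim: "\<forall>j. height a b (\<lambda>l. z (l + (a - k))) k \<le> height a b (\<lambda>l. z (l + (a - k))) j"
    if "k < a" "z \<in> Zseq a b" for k z
  proof -
    have z': "z \<in> Zseq' a b" using that Z by blast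
    have "(\<lambda>l. z (l + k + (a - k))) \<in> Zseq a b"
      using that unfolding shift_shift_back(1)[OF z' less_imp_le[OF that(1)]] by blast
    then show ?thesis using shift_Zseq_iff[OF a shift_Zseq'[OF a z']] by blast
  qed
  fix p q assume p: "p \<in> {..<a} \<times> (Zseq a b \<inter> W)" and q: "q \<in> {..<a} \<times> (Zseq a b \<inter> W)"
  obtain k z where kz: "p = (k, z)" "k < a" "z \<in> Zseq a b" "z \<in> Zseq' a b" using p Z by auto
  obtain k' z' where kz': "q = (k', z')" "k' < a" "z' \<in> Zseq a b" "z' \<in> Zseq' a b"
    using q Z by auto
  show "((case p of (k, z) \<Rightarrow> \<lambda>l. z (l + (a - k))) = (case q of (k, z) \<Rightarrow> \<lambda>l. z (l + (a - k))))
    = (p = q)"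
  proof
    assume "(case p of (k, z) \<Rightarrow> \<lambda>l. z (l + (a - k))) = (case q of (k, z) \<Rightarrow> \<lambda>l. z (l + (a - k)))"
    then have eq: "(\<lambda>l. z (l + (a - k))) = (\<lambda>l. z' (l + (a - k')))" using kz kz' by simp
    have "k = k'"
      using ex1_minimal_height[OF shift_Zseq'[OF a kz(4), of "a - k"]]
        minim[OF kz(2,3)] minim[OF kz'(2,3), folded eq] kz(2) kz'(2) by blast
    moreover have "z = z'"
    proof
      fix l
      have "z (l + k + (a - k)) = z' (l + k + (a - k))"
        using fun_cong[OF eq, of "l + k"] \<open>k = k'\<close> by simp
      then show "z l = z' l"
        unfolding shift_shift_back(1)[OF kz(4) less_imp_le[OF kz(2)]]
          shift_shift_back(1)[OF kz'(4) less_imp_le[OF kz(2)]] .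
    qed
    ultimately show "p = q" using kz kz' by simp
  qed simp
next
  fix p assume "p \<in> {..<a} \<times> (Zseq a b \<inter> W)"
  then show "(case p of (k, z) \<Rightarrow> \<lambda>l. z (l + (a - k))) \<in> Zseq' a b \<inter> W"
  proof (rule SigmaE)
    fix k z assume "z \<in> Zseq a b \<inter> W" "p = (k, z)"
    then show ?thesis
      using W[of z "a - k"] shift_Zseq'[OF a, where z = z and k = "a - k"] Zseq_iff_height[OF a, of z b] by simp
  qed
next
  fix w assume w: "w \<in> Zseq' a b \<inter> W"
  then obtain k where k: "k < a" "\<forall>j. height a b w k \<le> height a b w j"
    using ex1_minimal_height by blast
  then have "(\<lambda>l. w (l + k)) \<in> Zseq a b \<inter> W" using w shift_Zseq_iff[OF a] W by blast
  moreover have "w = (\<lambda>l. w (l + (a - k) + k))"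
    using w k(1) by (intro ext shift_shift_back(2)[symmetric]) auto
  ultimately show "\<exists>p\<in>{..<a} \<times> (Zseq a b \<inter> W). w = (case p of (k, z) \<Rightarrow> \<lambda>l. z (l + (a - k)))"
    using k(1) by (intro bexI[of _ "(k, \<lambda>l. w (l + k))"]) auto
qed

end

section \<open>Simultaneous cores\<close>

theorem theorem3p7:
  fixes a b n :: nat and c d :: "nat \<Rightarrow> nat"
  assumes "a > 0" and "b > 0" and "coprime a b"
    and "\<And>i. i \<in> {1..n} \<Longrightarrow> c i > 0"
    and "\<And>i. i \<in> {1..n} \<Longrightarrow> 1 \<le> d i \<and> d i \<le> a \<and> [b * d i + c i = 0] (mod a)"
  shows "(\<exists>f. bij_betw f (simultaneous_cores ({a, b} \<union> c ` {1..n}))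
            (Zseq a b \<inter> (\<Inter>i\<in>{1..n}. window_bounded (d i) (real (b * d i + c i) / real a))))
       \<and> finite (simultaneous_cores ({a, b} \<union> c ` {1..n}))
       \<and> finite (Zseq' a b \<inter> (\<Inter>i\<in>{1..n}. window_bounded (d i) (real (b * d i + c i) / real a)))
       \<and> real (card (simultaneous_cores ({a, b} \<union> c ` {1..n})))
         = 1 / real a *
           real (card (Zseq' a b \<inter> (\<Inter>i\<in>{1..n}. window_bounded (d i) (real (b * d i + c i) / real a))))"
proof -
  let ?T = "{a, b} \<union> c ` {1..n}"
  let ?W = "\<Inter>i\<in>{1..n}. window_bounded (d i) (real (b * d i + c i) / real a)"
  have cores: "bij_betw (\<lambda>p. - beta_set p) (simultaneous_cores ?T) (closed_cofinite ?T)"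
    using assms(1,2,4) by (intro bij_betw_cores_closed_cofinite) auto
  have seqs: "bij_betw (upper_set a b) (Zseq a b \<inter> ?W) (closed_cofinite ?T)"
    using assms(5) by (intro bij_betw_upper_set[OF assms(1,3)]) blast
  obtain f where f: "bij_betw f (simultaneous_cores ?T) (Zseq a b \<inter> ?W)"
    using bij_betw_trans[OF cores bij_betw_inv_into[OF seqs]] by (rule that)
  have "(\<lambda>l. z (l + k)) \<in> ?W" if "z \<in> ?W" for z k
    using that unfolding INT_iff by (intro ballI shift_window_bounded) simp
  then have "card ({..<a} \<times> (Zseq a b \<inter> ?W)) = card (Zseq' a b \<inter> ?W)"
    by (rule bij_betw_same_card[OF bij_betw_shift[OF assms(1,3)]])
  then have mult: "a * card (simultaneous_cores ?T) = card (Zseq' a b \<inter> ?W)"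
    using bij_betw_same_card[OF f] by (simp add: card_cartesian_product)
  have divide: "x = 1 / real a * y" if "real a * x = y" for x y
    using that assms(1) by auto
  from mult have "real a * real (card (simultaneous_cores ?T)) = real (card (Zseq' a b \<inter> ?W))"
    by (metis of_nat_mult)
  then have card: "real (card (simultaneous_cores ?T)) = 1 / real a * real (card (Zseq' a b \<inter> ?W))"
    by (rule divide)
  have "finite (Zseq a b \<inter> ?W)"
    using Zseq_iff_height[OF assms(1)] by (intro finite_subset[OF _ finite_Zseq'[OF assms(1)]]) auto
  then have "finite (simultaneous_cores ?T)" using bij_betw_finite[OF f] by blast
  then show ?thesis using f card finite_Int[OF disjI1[OF finite_Zseq'[OF assms(1)]]] by (intro conjI exI)
qed

end
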